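(* For every integer $n>2$, let $C_n(123,231)$ denote the number of cyclic permutations of length $n$ that avoid both patterns $123$ and $231$. Then \[ C_n(123,231)=\begin{cases} \phi(2k)=\phi(n/2) & \text{if } n=4k,\\[2pt] \phi(k+1)+\phi(2k+1)=\phi\!\left(\frac{n+2}{4}\right)+\phi\!\left(\frac{n}{2}\right) & \text{if } n=4k+2,\\[2pt] \phi(m)=\phi\!\left(\frac{n+1}{2}\right) & \text{if } n=2m-1, \end{cases} \] where $k$ and $m$ denote positive integers and $\phi$ is Euler's totient function.
   Context: A permutation of length $n$ is a linear order $p=p_1p_2\cdots p_n$ of $[n]=\{1,\dots,n\}$, also viewed as the bijection $i\mapsto p_i$. It is cyclic if, as a bijection of $[n]$, it consists of a single cycle of length $n$. A permutation $p$ contains a pattern $q=q_1\cdots q_k$ if there are indices $i_1<\cdots<i_k$ such that for all $j,r$, $q_j<q_r$ iff $p_{i_j}<p_{i_r}$; otherwise $p$ avoids $q$. For a positive integer $z$, $\phi(z)$ is the number of integers in $\{1,\dots,z\}$ relatively prime to $z$. *)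

theory Defs
  imports "HOL-Combinatorics.Orbits" "HOL-Number_Theory.Totient"
begin

text \<open>
  A permutation \<open>p\<^sub>1 p\<^sub>2 \<dots> p\<^sub>n\<close> is a function \<open>p\<close> with \<open>p permutes {1..n}\<close>, its entries being
  \<open>p\<^sub>i = p i\<close>. A pattern is given in one-line notation as a list, so its positions are
  counted from 0.
\<close>

definition contains_pattern :: "nat \<Rightarrow> (nat \<Rightarrow> nat) \<Rightarrow> nat list \<Rightarrow> bool" where
  "contains_pattern n p q \<longleftrightarrow>
     (\<exists>i :: nat \<Rightarrow> nat.
        strict_mono_on {..<length q} i \<and>
        (\<forall>j<length q. i j \<in> {1..n}) \<and>
        (\<forall>j<length q. \<forall>r<length q. q ! j < q ! r \<longleftrightarrow> p (i j) < p (i r)))"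

definition avoids_pattern :: "nat \<Rightarrow> (nat \<Rightarrow> nat) \<Rightarrow> nat list \<Rightarrow> bool" where
  "avoids_pattern n p q \<longleftrightarrow> \<not> contains_pattern n p q"

definition cyclic_permutation :: "nat \<Rightarrow> (nat \<Rightarrow> nat) \<Rightarrow> bool" where
  "cyclic_permutation n p \<longleftrightarrow> p permutes {1..n} \<and> cyclic_on p {1..n}"

definition num_cyclic_avoiding :: "nat \<Rightarrow> nat list set \<Rightarrow> nat" where
  "num_cyclic_avoiding n Q = card {p. cyclic_permutation n p \<and> (\<forall>q\<in>Q. avoids_pattern n p q)}"

end

theory Submission
  imports Defs
begin

text \<open>
  Let \<open>p\<close> avoid both patterns. The entries before the entry 1 decrease (no 231), the entries
  after it decrease (no 123), and the values after it form an interval (no 231). So there are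
  \<open>c + N = n\<close> and \<open>d < N\<close> such that \<open>p\<close> reverses \<open>i \<mapsto> n + 1 - i\<close> on \<open>{1..c}\<close> and sends
  \<open>c + 1 + x\<close> to \<open>N - (x + d) mod N\<close> for \<open>x < N\<close>.

  If \<open>c > N\<close> then \<open>p\<close> has a cycle of length at most 2. Otherwise \<open>p\<close> sends \<open>{1..c}\<close> into
  \<open>{c+1..n}\<close>, and the first return map to \<open>{c+1..n}\<close> is the rotation by \<open>d\<close> of the integers
  modulo \<open>N\<close>, followed by the reversal of the first \<open>e = N - c\<close> residues. This map is conjugated
  to its inverse by the involution that fixes \<open>0, \<dots>, e - 1\<close> and reverses the other residues.
  An involution inverting an \<open>N\<close>-cycle acts as a reflection of an \<open>N\<close>-gon and fixes at most
  two points, so \<open>e \<le> 2\<close>. For \<open>e \<le> 1\<close> the return map is the rotation itself, which is cyclic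
  iff \<open>gcd d N = 1\<close>. For \<open>e = 2\<close> it is the rotation followed by a transposition of two adjacent
  residues, which splits a single cycle and merges two cycles, so it is cyclic iff
  \<open>gcd d N = 2\<close>.
\<close>

section \<open>Cycles as maps without proper invariant subsets\<close>

definition irreducible_on :: "('a \<Rightarrow> 'a) \<Rightarrow> 'a set \<Rightarrow> bool" where
  "irreducible_on f S \<longleftrightarrow> (\<forall>T\<subseteq>S. T \<noteq> {} \<longrightarrow> f ` T \<subseteq> T \<longrightarrow> T = S)"

lemma irreducible_onD:
  assumes "irreducible_on f S" "T \<subseteq> S" "x \<in> T" "\<And>y. y \<in> T \<Longrightarrow> f y \<in> T"
  shows "T = S"
  using assms unfolding irreducible_on_def by blast

lemma irreducible_onI:
  assumes "\<And>T x. T \<subseteq> S \<Longrightarrow> x \<in> T \<Longrightarrow> (\<And>y. y \<in> T \<Longrightarrow> f y \<in> T) \<Longrightarrow> T = S"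
  shows "irreducible_on f S"
  using assms unfolding irreducible_on_def by (metis ex_in_conv image_subset_iff)

text \<open>An invariant set contains the orbit of each of its points, and an orbit is itself
  invariant. Invariant subsets, unlike cycles, are easy to carry over to a first return map.\<close>

lemma cyclic_on_iff_irreducible_on:
  assumes "S \<noteq> {}" "\<And>x. x \<in> S \<Longrightarrow> f x \<in> S"
  shows "cyclic_on f S \<longleftrightarrow> irreducible_on f S"
proof
  assume cyc: "cyclic_on f S"
  show "irreducible_on f S"
  proof (rule irreducible_onI)
    fix T x assume T: "T \<subseteq> S" "x \<in> T" "\<And>y. y \<in> T \<Longrightarrow> f y \<in> T"
    have "y \<in> T" if "y \<in> orbit f x" for y
      using that by induction (auto simp: T)
    moreover have "S = orbit f x"
      using cyc T by (auto simp: cyclic_on_alldef)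
    ultimately show "T = S" using T by blast
  qed
next
  assume irr: "irreducible_on f S"
  obtain s where s: "s \<in> S" using assms by blast
  have "y \<in> S" if "y \<in> orbit f s" for y
    using that by induction (auto simp: s assms)
  \<comment> \<open>\<open>orbit f s\<close> starts at \<open>f s\<close>, so \<open>f s\<close>
    serves as the known member; that \<open>s\<close> belongs to it is part of the
    conclusion.\<close>
  then have "orbit f s = S"
    by (intro irreducible_onD[OF irr, of _ "f s"]) (auto intro: orbit.intros)
  then show "cyclic_on f S"
    using s by (auto simp: cyclic_on_def)
qed

text \<open>Once \<open>x\<close> returns after \<open>m\<close> steps, its first \<open>m\<close>
  iterates form an invariant set and hence exhaust \<open>S\<close>.\<close>

lemma funpow_return_ge_card:
  assumes "irreducible_on f S" "\<And>x. x \<in> S \<Longrightarrow> f x \<in> S" "x \<in> S" "(f ^^ m) x = x" "m > 0"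
  shows "card S \<le> m"
proof -
  have inS: "(f ^^ k) x \<in> S" for k
    by (induction k) (auto simp: assms)
  have "(\<lambda>k. (f ^^ k) x) ` {..<m} = S"
  proof (rule irreducible_onD[OF assms(1)])
    show "(\<lambda>k. (f ^^ k) x) ` {..<m} \<subseteq> S" using inS by auto
    show "x \<in> (\<lambda>k. (f ^^ k) x) ` {..<m}" using assms(5) by (auto intro: image_eqI[of _ _ 0])
  next
    fix y assume "y \<in> (\<lambda>k. (f ^^ k) x) ` {..<m}"
    then obtain k where k: "k < m" "y = (f ^^ k) x" by auto
    show "f y \<in> (\<lambda>k. (f ^^ k) x) ` {..<m}"
    proof (cases "Suc k = m")
      case True
      then have "f y = (f ^^ 0) x" using k assms(4) by auto
      then show ?thesis using assms(5) by blast
    next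
      case False
      then have "Suc k \<in> {..<m}" "f y = (f ^^ Suc k) x" using k by auto
      then show ?thesis by blast
    qed
  qed
  then show ?thesis by (metis card_image_le card_lessThan finite_lessThan)
qed

text \<open>The iterates of \<open>x\<close> are invariant, so they meet \<open>y\<close>. Up to the
  least exponent reaching \<open>y\<close> they are distinct, and the pigeonhole principle bounds
  that exponent.\<close>

lemma irreducible_on_funpow_reach:
  assumes "irreducible_on f S" "finite S" "\<And>x. x \<in> S \<Longrightarrow> f x \<in> S" "x \<in> S" "y \<in> S"
  obtains k where "k < card S" "(f ^^ k) x = y"
proof -
  have inS: "(f ^^ k) x \<in> S" for k
    by (induction k) (auto simp: assms)
  have "range (\<lambda>k. (f ^^ k) x) = S"
  proof (rule irreducible_onD[OF assms(1)])
    show "range (\<lambda>k. (f ^^ k) x) \<subseteq> S" using inS by auto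
    show "x \<in> range (\<lambda>k. (f ^^ k) x)" by (auto intro: image_eqI[of _ _ 0])
    show "f z \<in> range (\<lambda>k. (f ^^ k) x)" if z: "z \<in> range (\<lambda>k. (f ^^ k) x)" for z
    proof -
      obtain k where "z = (f ^^ k) x" using z by blast
      then have "f z = (f ^^ Suc k) x" by simp
      then show ?thesis by blast
    qed
  qed
  then have ex: "\<exists>k. (f ^^ k) x = y" using assms(5) by blast
  define k where "k = (LEAST k. (f ^^ k) x = y)"
  have k: "(f ^^ k) x = y" unfolding k_def by (rule LeastI_ex[OF ex])
  have least: "(f ^^ j) x \<noteq> y" if "j < k" for j
    using that unfolding k_def by (rule not_less_Least)
  have "inj_on (\<lambda>i. (f ^^ i) x) {..k}"
  proof (rule linorder_inj_onI')
    fix i j assume ij: "i \<in> {..k}" "j \<in> {..k}" "i < j"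
    show "(f ^^ i) x \<noteq> (f ^^ j) x"
    proof
      assume eq: "(f ^^ i) x = (f ^^ j) x"
      \<comment> \<open>A repeated iterate allows the loop between times \<open>i\<close> and
        \<open>j\<close> to be cut out, so \<open>y\<close> is reached too early.\<close>
      have "(f ^^ (k - j + i)) x = (f ^^ (k - j)) ((f ^^ j) x)"
        by (simp add: funpow_add eq)
      also have "\<dots> = y" using k ij by (simp flip: comp_apply[of "f ^^ _"] funpow_add)
      finally show False using least[of "k - j + i"] ij by (metis add_less_mono1 atMost_iff le_add_diff_inverse2 nat_add_left_cancel_less)
    qed
  qed
  then have "card ((\<lambda>i. (f ^^ i) x) ` {..k}) = Suc k" by (simp add: card_image)
  moreover have "card ((\<lambda>i. (f ^^ i) x) ` {..k}) \<le> card S"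
    using assms(2) inS by (intro card_mono) auto
  ultimately show ?thesis using that[of k] k by simp
qed

text \<open>The condition \<open>f (g (f x)) = g x\<close> says that \<open>g\<close> conjugates \<open>f\<close> to its inverse.\<close>

lemma reversor_fixes_at_most_two:
  assumes irr: "irreducible_on f S" and fin: "finite S"
    and fS: "\<And>x. x \<in> S \<Longrightarrow> f x \<in> S" and inj: "inj_on f S"
    and rev: "\<And>x. x \<in> S \<Longrightarrow> f (g (f x)) = g x"
    and S: "x \<in> S" "y \<in> S" "z \<in> S" and fix_g: "g x = x" "g y = y" "g z = z"
  shows "x = y \<or> x = z \<or> y = z"
proof (rule ccontr)
  assume distinct: "\<not> ?thesis"
  have iter_in: "(f ^^ k) w \<in> S" if "w \<in> S" for k w
    using that by (induction k) (auto simp: fS)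
  have reversed: "(f ^^ k) (g ((f ^^ k) w)) = g w" if "w \<in> S" for k w
    using that
  proof (induction k arbitrary: w)
    case (Suc k)
    have "(f ^^ Suc k) (g ((f ^^ Suc k) w)) = (f ^^ k) (f (g (f ((f ^^ k) w))))"
      by (simp add: funpow_swap1)
    then show ?case using Suc by (simp add: rev iter_in)
  qed simp
  \<comment> \<open>If \<open>g\<close> fixes both \<open>x\<close> and its \<open>k\<close>-th
    iterate, \<open>reversed\<close> says that \<open>k\<close> further steps lead back to
    \<open>x\<close>.\<close>
  have double: "(f ^^ (2 * k)) x = x" if "g ((f ^^ k) x) = (f ^^ k) x" for k
    using reversed[OF S(1), of k] that fix_g by (simp add: mult_2 funpow_add)
  have False if i: "(f ^^ i) x = u" "i \<noteq> 0" and j: "(f ^^ j) x = v" "i < j" "j < card S"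
    and u: "g u = u" and v: "g v = v" for i j u v
  proof -
    have 1: "(f ^^ (2 * i)) x = x" and 2: "(f ^^ (2 * j)) x = x"
      using double i j u v by auto
    have "(f ^^ (2 * j)) x = (f ^^ (2 * (j - i))) ((f ^^ (2 * i)) x)"
      using j by (simp flip: comp_apply[of "f ^^ _"] funpow_add add: algebra_simps)
    then have "(f ^^ (2 * (j - i))) x = x" using 1 2 by simp
    \<comment> \<open>Two more fixed points at times \<open>i < j\<close> give returns after
      \<open>2 * i\<close> and \<open>2 * (j - i)\<close> steps. Adding the two bounds yields
      \<open>card S \<le> j\<close>.\<close>
    then have "card S \<le> 2 * (j - i)" "card S \<le> 2 * i"
      using 1 i j by (auto intro!: funpow_return_ge_card[OF irr fS S(1)])
    then show False using j by linarith
  qed note * = this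
  obtain i where i: "i < card S" "(f ^^ i) x = y"
    using irreducible_on_funpow_reach[OF irr fin fS S(1,2)] by metis
  obtain j where j: "j < card S" "(f ^^ j) x = z"
    using irreducible_on_funpow_reach[OF irr fin fS S(1,3)] by metis
  have "i \<noteq> 0" "j \<noteq> 0" "i \<noteq> j" using i j distinct by (auto intro!: Nat.gr0I)
  then show False
    using *[of i y j z] *[of j z i y] i j fix_g by (cases "i < j") auto
qed

section \<open>Rotations followed by the reversal of an initial segment\<close>

text \<open>For \<open>e = N - c\<close> this is the return map to the positions above
  \<open>c\<close>, with \<open>x\<close> standing for position \<open>c + 1 + x\<close>.\<close>

definition flip_rot :: "nat \<Rightarrow> nat \<Rightarrow> nat \<Rightarrow> nat \<Rightarrow> nat" where
  "flip_rot N e d x = (let y = (x + d) mod N in if y < e then e - 1 - y else y)"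

lemma rot_eq:
  fixes x d N :: nat
  assumes "x < N" "d < N"
  shows "(x + d) mod N = (if x + d < N then x + d else x + d - N)"
  using assms by (simp add: mod_if)

lemma flip_rot_less:
  assumes "N > 0" "e \<le> N"
  shows "flip_rot N e d x < N"
  using assms by (auto simp: flip_rot_def Let_def)

lemma inj_on_flip_rot:
  assumes "d < N" "e \<le> N"
  shows "inj_on (flip_rot N e d) {..<N}"
  by (rule inj_onI) (use assms in \<open>auto simp: flip_rot_def Let_def rot_eq split: if_splits\<close>)

text \<open>The reversal followed by \<open>g\<close> is the reflection
  \<open>y \<mapsto> e - 1 - y\<close> modulo \<open>N\<close>, which conjugates the rotation to its
  inverse. As \<open>g\<close> commutes with the reversal, it inverts the whole map, and for
  \<open>e > 2\<close> it fixes 0, 1 and 2.\<close>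

lemma irreducible_flip_rot_le_2:
  assumes irr: "irreducible_on (flip_rot N e d) {..<N}" and "d < N" "e \<le> N"
  shows "e \<le> 2"
proof (rule ccontr)
  assume "\<not> e \<le> 2"
  define g where "g x = (if x < e then x else N + e - 1 - x)" for x
  have "flip_rot N e d (g (flip_rot N e d x)) = g x" if "x < N" for x
  proof -
    define y where "y = (x + d) mod N"
    have "y < N" using assms by (simp add: y_def)
    have y: "y = (if x + d < N then x + d else x + d - N)"
      unfolding y_def using that assms by (simp add: rot_eq)
    define z where "z = (if y < e then e - 1 - y else N + e - 1 - y)"
    have "z < N" using \<open>y < N\<close> assms by (auto simp: z_def)
    have z: "g (flip_rot N e d x) = z"
      using \<open>y < N\<close> by (auto simp: flip_rot_def Let_def g_def z_def simp flip: y_def)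
    define w where "w = (z + d) mod N"
    have "w < N" using assms by (simp add: w_def)
    have w: "z + d = w \<or> z + d = w + N"
      unfolding w_def using rot_eq[OF \<open>z < N\<close> \<open>d < N\<close>] by auto
    have "x + d = y \<or> x + d = y + N" using y by auto
    moreover have "z + y + 1 = e \<or> z + y + 1 = N + e" using \<open>y < N\<close> by (auto simp: z_def)
    \<comment> \<open>The two shifts by \<open>d\<close> cancel: \<open>w\<close> is congruent to
      \<open>e - 1 - x\<close> modulo \<open>N\<close>, and the ranges leave only two multiples of
      \<open>N\<close>.\<close>
    ultimately have "w + x + 1 = e \<or> w + x + 1 = N + e"
      using w \<open>w < N\<close> \<open>x < N\<close> \<open>e \<le> N\<close> \<open>\<not> e \<le> 2\<close> by (elim disjE) linarith+
    then have "w = (if x < e then e - 1 - x else N + e - 1 - x)"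
      using \<open>w < N\<close> by auto
    then have "(if w < e then e - 1 - w else w) = g x"
      using \<open>x < N\<close> by (cases "x < e") (simp_all add: g_def)
    then show ?thesis
      unfolding z by (simp only: flip_rot_def Let_def w_def)
  qed
  then have "(0::nat) = 1 \<or> (0::nat) = 2 \<or> (1::nat) = 2"
  proof (intro reversor_fixes_at_most_two[OF irr finite_lessThan, where g = g])
    show "inj_on (flip_rot N e d) {..<N}" using assms by (intro inj_on_flip_rot)
    show "flip_rot N e d x \<in> {..<N}" for x using assms by (simp add: flip_rot_less)
  qed (use \<open>\<not> e \<le> 2\<close> assms in \<open>auto simp: g_def\<close>)
  then show False by simp
qed

text \<open>This solves the linear congruence \<open>d * k = y - x\<close> modulo \<open>N\<close>;
  the added \<open>N\<close> keeps the subtraction from truncating.\<close>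

lemma rot_reach:
  fixes x y d N :: nat
  assumes "x < N" "y < N" "gcd d N dvd y + N - x"
  obtains k where "(x + k * d) mod N = y"
proof -
  obtain k where "[d * k = y + N - x] (mod N)"
    using cong_solve_dvd_nat[OF assms(3)] by blast
  then have "[x + d * k = x + (y + N - x)] (mod N)"
    by (intro cong_add) auto
  then have "(x + k * d) mod N = y"
    using assms by (simp add: cong_def mult.commute)
  then show ?thesis using that by blast
qed

text \<open>Reversing at most one residue does nothing. The multiples of \<open>gcd d N\<close> are
  invariant under the rotation, and for gcd 1 the rotation reaches every residue.\<close>

lemma irreducible_flip_rot_le_1_iff:
  assumes "N > 0" "e \<le> 1"
  shows "irreducible_on (flip_rot N e d) {..<N} \<longleftrightarrow> coprime d N"
proof -
  have F: "flip_rot N e d x = (x + d) mod N" for x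
    using assms by (auto simp: flip_rot_def Let_def)
  show ?thesis
  proof
    assume irr: "irreducible_on (flip_rot N e d) {..<N}"
    have "{x. x < N \<and> gcd d N dvd x} = {..<N}"
      by (rule irreducible_onD[OF irr, of _ 0]) (use assms in \<open>auto simp: F dvd_mod\<close>)
    then have "N > 1 \<Longrightarrow> gcd d N dvd 1" by blast
    then show "coprime d N"
      using assms by (cases "N = 1") (auto simp: coprime_iff_gcd_eq_1)
  next
    assume co: "coprime d N"
    show "irreducible_on (flip_rot N e d) {..<N}"
    proof (rule irreducible_onI)
      fix T x assume T: "T \<subseteq> {..<N}" "x \<in> T" "\<And>y. y \<in> T \<Longrightarrow> flip_rot N e d y \<in> T"
      have *: "(x + k * d) mod N \<in> T" for k
      proof (induction k)
        case 0
        then show ?case using T by auto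
      next
        case (Suc k)
        then show ?case using T(3)[OF Suc] by (simp add: F mod_simps add_ac)
      qed
      have "y \<in> T" if "y < N" for y
        using rot_reach[of x N y d] * T that co by auto
      then show "T = {..<N}" using T by auto
    qed
  qed
qed

lemma flip_rot_2:
  "flip_rot N 2 d x = (let y = (x + d) mod N in if y < 2 then 1 - y else y)"
  by (auto simp: flip_rot_def Let_def)

text \<open>The rotation preserves residue classes modulo \<open>h\<close>, and the swap of 0 and 1
  joins only two of them, so \<open>h \<le> 2\<close>. If \<open>h = 1\<close>, the swap cuts the
  single cycle of the rotation in two.\<close>

lemma irreducible_flip_rot_2_gcd:
  assumes irr: "irreducible_on (flip_rot N 2 d) {..<N}" and N: "N \<ge> 2"
  shows "gcd d N = 2"
proof -
  define h where "h = gcd d N"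
  have h: "h dvd d" "h dvd N" "h > 0" using N by (auto simp: h_def)
  have "h \<le> 2"
  proof (rule ccontr)
    assume "\<not> h \<le> 2"
    have "{x. x < N \<and> x mod h < 2} = {..<N}"
    proof (rule irreducible_onD[OF irr, of _ 0])
      fix x assume "x \<in> {x. x < N \<and> x mod h < 2}"
      then have x: "x < N" "x mod h < 2" by auto
      have "(x + d) mod N mod h = x mod h"
        using h by (metis mod_mod_cancel mod_add_right_eq mod_0_imp_dvd dvd_imp_mod_0 add_0_right)
      then show "flip_rot N 2 d x \<in> {x. x < N \<and> x mod h < 2}"
        using x N \<open>\<not> h \<le> 2\<close> by (auto simp: flip_rot_2 Let_def)
    qed (use N in auto)
    moreover have "h \<le> N" using h N by (simp add: dvd_imp_le)
    then have "2 \<in> {..<N}" using \<open>\<not> h \<le> 2\<close> by simp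
    ultimately have "2 mod h < 2" by blast
    then show False using \<open>\<not> h \<le> 2\<close> by simp
  qed
  moreover have "h \<noteq> 1"
  proof
    assume "h = 1"
    then have "\<exists>k. (k * d) mod N = 1"
      using rot_reach[of 0 N 1 d] N by (auto simp: h_def)
    define k where "k = (LEAST k. (k * d) mod N = 1)"
    have k: "(k * d) mod N = 1"
      unfolding k_def by (rule LeastI_ex) fact
    have least: "(j * d) mod N \<noteq> 1" if "j < k" for j
      using that unfolding k_def by (rule not_less_Least)
    have "k > 0" using k N by (intro Nat.gr0I) auto
    \<comment> \<open>The path \<open>0, d, 2 * d, ...\<close> is stopped just before the rotation
      would produce 1; the swap turns that 1 into 0 and closes a cycle avoiding 1.\<close>
    have "(\<lambda>i. (i * d) mod N) ` {..<k} = {..<N}"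
    proof (rule irreducible_onD[OF irr, of _ 0])
      fix x assume "x \<in> (\<lambda>i. (i * d) mod N) ` {..<k}"
      then obtain i where i: "i < k" "x = (i * d) mod N" by auto
      have xd: "(x + d) mod N = (Suc i * d) mod N"
        using i by (simp add: mod_simps add_ac)
      show "flip_rot N 2 d x \<in> (\<lambda>i. (i * d) mod N) ` {..<k}"
      proof (cases "Suc i = k")
        case True
        then have "flip_rot N 2 d x = (0 * d) mod N"
          using xd k by (simp add: flip_rot_2)
        then show ?thesis using \<open>k > 0\<close> by blast
      next
        case False
        then have "Suc i < k" using i by simp
        \<comment> \<open>Passing through 0 before time \<open>k\<close> would mean that 1 is
          reached already after \<open>k - Suc i\<close> steps.\<close>
        have "(Suc i * d) mod N \<noteq> 0"
        proof
          assume 0: "(Suc i * d) mod N = 0"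
          have "k * d = (k - Suc i) * d + Suc i * d"
            using \<open>Suc i < k\<close> by (metis add_mult_distrib le_add_diff_inverse2 less_imp_le)
          then have "(k * d) mod N = ((k - Suc i) * d) mod N"
            using 0 by (metis mod_add_right_eq add_0_right)
          then show False using least[of "k - Suc i"] k \<open>Suc i < k\<close> by simp
        qed
        then have "flip_rot N 2 d x = (Suc i * d) mod N"
          using least[OF \<open>Suc i < k\<close>] xd by (simp add: flip_rot_2 Let_def)
        then show ?thesis using \<open>Suc i < k\<close> by blast
      qed
    qed (use N \<open>k > 0\<close> in \<open>auto intro: image_eqI[of _ _ 0]\<close>)
    moreover have "1 \<notin> (\<lambda>i. (i * d) mod N) ` {..<k}" using least by force
    moreover have "1 \<in> {..<N}" using N by simp
    ultimately show False by blast
  qed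
  ultimately show ?thesis using h(3) unfolding h_def by linarith
qed

text \<open>The rotation has two cycles, the even and the odd residues, and the swap of 0 and 1
  merges them.\<close>

lemma gcd_2_irreducible_flip_rot:
  assumes gcd: "gcd d N = 2" and N: "N > 0" and "d < N"
  shows "irreducible_on (flip_rot N 2 d) {..<N}"
proof (rule irreducible_onI)
  fix T x assume T: "T \<subseteq> {..<N}" "x \<in> T" "\<And>y. y \<in> T \<Longrightarrow> flip_rot N 2 d y \<in> T"
  have ev: "even d" "even N" using gcd by (metis gcd_dvd1, metis gcd_dvd2)
  have "N \<ge> 2" using N ev by (auto elim!: evenE)
  have reach: "\<exists>k. (u + k * d) mod N = v" if "u < N" "v < N" "even u \<longleftrightarrow> even v" for u v
    using rot_reach[of u N v d] that gcd ev by auto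
  have step: "(w + d) mod N \<in> T \<or> 1 - (w + d) mod N \<in> T \<and> (w + d) mod N < 2"
    if "w \<in> T" for w
    using T(3)[OF that] by (auto simp: flip_rot_2 Let_def split: if_splits)
  have parity: "even ((u + k * d) mod N) \<longleftrightarrow> even u" for u k
    using ev by (simp add: dvd_mod_iff)
  have suc: "((u + k * d) mod N + d) mod N = (u + Suc k * d) mod N" for u k
    by (simp add: mod_simps add_ac)
  \<comment> \<open>Along the rotation from \<open>s\<close>, the only residue below 2 with the
    parity of \<open>s\<close> is \<open>s\<close> itself, so the swap interferes only when the
    class has closed up.\<close>
  have all_of_start: "y \<in> T" if s: "s \<in> T" "s < 2" and y: "y < N" "even y \<longleftrightarrow> even s" for s y
  proof -
    have *: "(s + k * d) mod N \<in> T" for k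
    proof (induction k)
      case 0
      then show ?case using s \<open>N \<ge> 2\<close> by simp
    next
      case (Suc k)
      let ?y = "(s + Suc k * d) mod N"
      have "?y < 2 \<Longrightarrow> ?y = s"
        using parity[of s "Suc k"] s(2) by (cases "?y = 0"; cases "s = 0") (auto simp: less_2_cases_iff)
      then show ?case using step[OF Suc] s unfolding suc by auto
    qed
    show ?thesis using reach[of s y] * s y \<open>N \<ge> 2\<close> by auto
  qed
  have other: "1 - s \<in> T" if s: "s \<in> T" "s < 2" for s
  proof -
    \<comment> \<open>The rotation sends \<open>w\<close> to \<open>s\<close>, so
      \<open>flip_rot\<close> sends it to \<open>1 - s\<close>.\<close>
    define w where "w = (s + (N - d)) mod N"
    have "w \<in> T"
      by (rule all_of_start[OF s]) (use N ev \<open>d < N\<close> in \<open>auto simp: w_def dvd_mod_iff\<close>)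
    moreover have "(w + d) mod N = s"
      using \<open>d < N\<close> \<open>N \<ge> 2\<close> s by (simp add: w_def mod_simps)
    ultimately show ?thesis
      using T(3)[of w] s by (simp add: flip_rot_2)
  qed
  \<comment> \<open>A set missing 0 and 1 never feels the swap, so the rotation would carry
    \<open>x\<close> to \<open>x mod 2\<close> inside it.\<close>
  have "\<exists>s<2. s \<in> T"
  proof (rule ccontr)
    assume no: "\<not> ?thesis"
    have *: "(x + k * d) mod N \<in> T" for k
    proof (induction k)
      case 0
      then show ?case using T by auto
    next
      case (Suc k)
      then show ?case using step[OF Suc] no unfolding suc by auto
    qed
    have "x < N" using T by auto
    moreover have "x mod 2 < 2" by simp
    moreover have "even x \<longleftrightarrow> even (x mod 2)" by simp
    ultimately obtain k where "(x + k * d) mod N = x mod 2"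
      using reach[of x "x mod 2"] \<open>N \<ge> 2\<close> by (meson less_le_trans)
    then have "x mod 2 \<in> T" using *[of k] by simp
    then show False using no \<open>x mod 2 < 2\<close> by blast
  qed
  then obtain s where "s < 2" "s \<in> T" by blast
  then have 01: "0 \<in> T" "1 \<in> T" using other[of s] by (auto simp: less_2_cases_iff)
  have "y \<in> T" if "y < N" for y
    using all_of_start[of 0 y] all_of_start[of 1 y] 01 that by (cases "even y") auto
  then show "T = {..<N}" using T by auto
qed

section \<open>Block permutations and their first return maps\<close>

text \<open>For \<open>d < N\<close> the entries are \<open>c + N, ..., N + 1\<close>, then
  \<open>N - d, ..., 1\<close>, then \<open>N, ..., N - d + 1\<close>, the last run being empty for
  \<open>d = 0\<close>.\<close>

definition block_perm :: "nat \<Rightarrow> nat \<Rightarrow> nat \<Rightarrow> nat \<Rightarrow> nat" where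
  "block_perm c N d i =
     (if i = 0 \<or> c + N < i then i
      else if i \<le> c then c + N + 1 - i
      else N - (i - c - 1 + d) mod N)"

lemma block_perm_low: "0 < i \<Longrightarrow> i \<le> c \<Longrightarrow> block_perm c N d i = c + N + 1 - i"
  by (simp add: block_perm_def)

lemma block_perm_high: "x < N \<Longrightarrow> block_perm c N d (c + 1 + x) = N - (x + d) mod N"
  by (simp add: block_perm_def)

text \<open>The remainder wraps around at most once. The resulting linear pieces reduce injectivity
  and pattern avoidance to linear arithmetic.\<close>

lemma block_perm_pieces:
  assumes "d < N" "0 < i" "i \<le> c + N"
  shows "block_perm c N d i =
     (if i \<le> c then c + N + 1 - i
      else if i \<le> c + (N - d) then c + N + 1 - d - i
      else c + 2 * N + 1 - d - i)"
proof (cases "i \<le> c")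
  case False
  then have "(i - c - 1 + d) mod N =
      (if i - c - 1 + d < N then i - c - 1 + d else i - c - 1 + d - N)"
    using assms by (intro rot_eq) auto
  then show ?thesis using False assms by (auto simp: block_perm_def)
qed (use assms in \<open>auto simp: block_perm_def\<close>)

lemma block_perm_permutes:
  assumes "d < N"
  shows "block_perm c N d permutes {1..c + N}"
proof (rule bij_imp_permutes)
  have "inj_on (block_perm c N d) {1..c + N}"
    by (rule inj_onI) (use assms in \<open>auto simp: block_perm_pieces split: if_splits\<close>)
  moreover have "block_perm c N d ` {1..c + N} \<subseteq> {1..c + N}"
    using assms by (auto simp: block_perm_pieces)
  ultimately show "bij_betw (block_perm c N d) {1..c + N} {1..c + N}"
    by (simp add: bij_betw_def endo_inj_surj)
qed (auto simp: block_perm_def)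

text \<open>Let \<open>y = (x + d) mod N\<close>. The image \<open>N - y\<close> of position
  \<open>c + 1 + x\<close> lies above \<open>c\<close> iff \<open>y < N - c\<close>, which gives the
  reversed residues. Otherwise it lies in \<open>{1..c}\<close>, and one more step leads to
  \<open>c + 1 + y\<close>.\<close>

lemma block_perm_irreducible_iff:
  assumes "d < N" "c \<le> N"
  shows "irreducible_on (block_perm c N d) {1..c + N} \<longleftrightarrow>
         irreducible_on (flip_rot N (N - c) d) {..<N}"
proof -
  let ?p = "block_perm c N d" and ?F = "flip_rot N (N - c) d"
  have low: "?p i = c + 1 + (N - i)" if "0 < i" "i \<le> c" for i
    using that assms by (simp add: block_perm_low)
  have high: "?p (c + 1 + x) = N - (x + d) mod N" if "x < N" for x
    using that by (rule block_perm_high)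
  have stay: "?p (c + 1 + x) = c + 1 + ?F x" if "x < N" "(x + d) mod N < N - c" for x
    using that unfolding high[OF that(1)] by (simp add: flip_rot_def)
  have pass: "?F x = (x + d) mod N" if "\<not> (x + d) mod N < N - c" for x
    using that by (simp add: flip_rot_def)
  have rot_less: "(x + d) mod N < N" for x using assms by simp
  show ?thesis
  proof
    assume irr: "irreducible_on ?p {1..c + N}"
    show "irreducible_on ?F {..<N}"
    proof (rule irreducible_onI)
      fix T x assume T: "T \<subseteq> {..<N}" "x \<in> T" "\<And>y. y \<in> T \<Longrightarrow> ?F y \<in> T"
      \<comment> \<open>A position \<open>i \<le> c\<close> is mapped to
        \<open>c + 1 + (N - i)\<close>, so it is added exactly when that image is present.\<close>
      define T' where "T' = (\<lambda>x. c + 1 + x) ` T \<union> {i \<in> {1..c}. N - i \<in> T}"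
      have "T' = {1..c + N}"
      proof (rule irreducible_onD[OF irr, of _ "c + 1 + x"])
        fix i assume "i \<in> T'"
        then consider y where "i = c + 1 + y" "y \<in> T" | "0 < i" "i \<le> c" "N - i \<in> T"
          by (auto simp: T'_def)
        then show "?p i \<in> T'"
        proof cases
          case 1
          then have "y < N" using T by auto
          show ?thesis
          proof (cases "(y + d) mod N < N - c")
            case True
            then have "?p i = c + 1 + ?F y" using stay \<open>y < N\<close> 1 by blast
            then show ?thesis using T(3)[OF 1(2)] by (auto simp: T'_def)
          next
            case False
            then have "?F y = (y + d) mod N" by (rule pass)
            then have "(y + d) mod N \<in> T" using T(3)[OF 1(2)] by simp
            moreover have "?p i = N - (y + d) mod N" using high \<open>y < N\<close> 1 by blast
            ultimately show ?thesis using False rot_less[of y] by (auto simp: T'_def)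
          qed
        next
          case 2
          then show ?thesis by (auto simp: T'_def low)
        qed
      qed (use T in \<open>auto simp: T'_def\<close>)
      have "y \<in> T" if "y < N" for y
      proof -
        have "c + 1 + y \<in> T'" using \<open>T' = {1..c + N}\<close> that by auto
        then show ?thesis by (auto simp: T'_def)
      qed
      then show "T = {..<N}" using T by auto
    qed
  next
    assume irr: "irreducible_on ?F {..<N}"
    show "irreducible_on ?p {1..c + N}"
    proof (rule irreducible_onI)
      fix T i assume T: "T \<subseteq> {1..c + N}" "i \<in> T" "\<And>y. y \<in> T \<Longrightarrow> ?p y \<in> T"
      have "\<exists>x<N. c + 1 + x \<in> T"
      proof (cases "i \<le> c")
        case True
        moreover have "0 < i" using T by auto
        ultimately show ?thesis using low[of i] T(3)[OF T(2)] assms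
          by (intro exI[of _ "N - i"]) auto
      next
        case False
        then have "i = c + 1 + (i - c - 1)" "i - c - 1 < N" using T by auto
        then show ?thesis using T(2) by metis
      qed
      then obtain x where x: "x < N" "c + 1 + x \<in> T" by blast
      have "{x. x < N \<and> c + 1 + x \<in> T} = {..<N}"
      proof (rule irreducible_onD[OF irr, of _ x])
        fix y assume "y \<in> {x. x < N \<and> c + 1 + x \<in> T}"
        then have y: "y < N" "c + 1 + y \<in> T" by auto
        have "c + 1 + ?F y \<in> T"
        proof (cases "(y + d) mod N < N - c")
          case True
          then show ?thesis using stay y T(3) by metis
        next
          case False
          define j where "j = N - (y + d) mod N"
          have j: "0 < j" "j \<le> c" "N - j = ?F y"
            using False rot_less[of y] pass[of y] by (auto simp: j_def)
          have "j \<in> T" using T(3)[OF y(2)] high[OF y(1)] by (simp add: j_def)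
          then show ?thesis using T(3) low[of j] j by metis
        qed
        then show "?F y \<in> {x. x < N \<and> c + 1 + x \<in> T}"
          using flip_rot_less[of N "N - c" d y] assms by auto
      qed (use x in auto)
      then have upper: "c + 1 + y \<in> T" if "y < N" for y using that by blast
      have "j \<in> T" if "0 < j" "j \<le> c" for j
      proof -
        \<comment> \<open>Position \<open>c + 1 + y\<close> is the preimage of \<open>j\<close>: the
          rotation takes \<open>y\<close> to \<open>N - j\<close>.\<close>
        define y where "y = (N - j + (N - d)) mod N"
        have "(y + d) mod N = (N - j + (N - d) + d) mod N" by (simp add: y_def mod_simps)
        also have "\<dots> = (N - j + N) mod N" using assms by (simp add: add.assoc)
        also have "\<dots> = N - j" using assms that by (subst mod_add_self2) simp
        finally have y: "(y + d) mod N = N - j" .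
        have "y < N" using assms by (simp add: y_def)
        then have "?p (c + 1 + y) = j"
          unfolding high[OF \<open>y < N\<close>] y using assms that by simp
        then show ?thesis using T(3)[OF upper[OF \<open>y < N\<close>]] by simp
      qed
      moreover have "j \<in> T" if "c < j" "j \<le> c + N" for j
        using upper[of "j - c - 1"] that by simp
      ultimately have "j \<in> T" if "j \<in> {1..c + N}" for j
        using that by (cases "j \<le> c") auto
      then show "T = {1..c + N}" using T(1) by blast
    qed
  qed
qed

lemma two_cycle_not_irreducible:
  assumes "irreducible_on f S" "x \<in> S" "f x \<in> S" "f (f x) = x"
  shows "card S \<le> 2"
proof -
  have "{x, f x} = S"
    by (rule irreducible_onD[OF assms(1), of _ x]) (use assms in auto)
  moreover have "card {x, f x} \<le> 2" by (simp add: card_insert_if)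
  ultimately show ?thesis by simp
qed

text \<open>The three cases are \<open>e = 0, 1, 2\<close> for \<open>e = N - c\<close>; the parity
  of \<open>c + N\<close> separates \<open>e = 1\<close> from the others.\<close>

definition cyclic_params :: "nat \<Rightarrow> nat \<Rightarrow> nat \<Rightarrow> bool" where
  "cyclic_params c N d \<longleftrightarrow>
     N = c \<and> coprime d N \<or> N = c + 1 \<and> coprime d N \<or> N = c + 2 \<and> gcd d N = 2"

lemma cyclic_block_perm_iff:
  assumes "c + N > 2" "d < N"
  shows "cyclic_permutation (c + N) (block_perm c N d) \<longleftrightarrow> 0 < d \<and> cyclic_params c N d"
proof -
  let ?p = "block_perm c N d"
  have perm: "?p permutes {1..c + N}" by (rule block_perm_permutes) fact
  have "cyclic_permutation (c + N) ?p \<longleftrightarrow> irreducible_on ?p {1..c + N}"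
    unfolding cyclic_permutation_def
    using perm assms by (subst cyclic_on_iff_irreducible_on) (auto dest: permutes_in_image)
  also have "\<dots> \<longleftrightarrow> 0 < d \<and> cyclic_params c N d"
  proof
    assume irr: "irreducible_on ?p {1..c + N}"
    have no2: "?p (?p i) \<noteq> i" if "i \<in> {1..c + N}" for i
      using two_cycle_not_irreducible[OF irr that] permutes_in_image[OF perm] that assms by auto
    have "d > 0"
    proof (rule Nat.gr0I)
      assume "d = 0"
      \<comment> \<open>For \<open>d = 0\<close> the permutation is the full reversal, which
        exchanges 1 and \<open>c + N\<close>.\<close>
      then have "?p (?p 1) = 1" using assms by (auto simp: block_perm_pieces)
      then show False using no2[of 1] assms by auto
    qed
    have "c \<le> N"
    proof (rule ccontr)
      assume "\<not> c \<le> N"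
      \<comment> \<open>Both \<open>c\<close> and its image \<open>N + 1\<close> lie in the initial
        block, where the reversal undoes itself.\<close>
      then have "?p (?p c) = c" using assms by (auto simp: block_perm_low)
      then show False using no2[of c] \<open>\<not> c \<le> N\<close> by auto
    qed
    then have irrF: "irreducible_on (flip_rot N (N - c) d) {..<N}"
      using irr block_perm_irreducible_iff assms by blast
    have "N - c \<le> 2" using irreducible_flip_rot_le_2[OF irrF] assms by auto
    moreover have "N - c \<le> 1 \<Longrightarrow> coprime d N"
      using irreducible_flip_rot_le_1_iff[of N "N - c" d] irrF assms by auto
    moreover have "N - c = 2 \<Longrightarrow> gcd d N = 2"
      using irreducible_flip_rot_2_gcd[of N d] irrF by auto
    ultimately show "0 < d \<and> cyclic_params c N d"
      using \<open>d > 0\<close> \<open>c \<le> N\<close> by (cases "N - c \<le> 1") (auto simp: cyclic_params_def)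
  next
    assume "0 < d \<and> cyclic_params c N d"
    then have cases: "c \<le> N" "N - c \<le> 1 \<and> coprime d N \<or> N - c = 2 \<and> gcd d N = 2"
      by (auto simp: cyclic_params_def)
    then have "irreducible_on (flip_rot N (N - c) d) {..<N}"
      using irreducible_flip_rot_le_1_iff[of N "N - c" d] gcd_2_irreducible_flip_rot[of d N] assms
      by auto
    then show "irreducible_on ?p {1..c + N}"
      using block_perm_irreducible_iff cases assms by blast
  qed
  finally show ?thesis .
qed


section \<open>The structure of permutations avoiding 123 and 231\<close>

lemma contains_pattern_3:
  "contains_pattern n p [a, b, c] \<longleftrightarrow>
     (\<exists>i j k. 0 < i \<and> i < j \<and> j < k \<and> k \<le> n \<and>
        (a < b \<longleftrightarrow> p i < p j) \<and> (b < a \<longleftrightarrow> p j < p i) \<and>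
        (a < c \<longleftrightarrow> p i < p k) \<and> (c < a \<longleftrightarrow> p k < p i) \<and>
        (b < c \<longleftrightarrow> p j < p k) \<and> (c < b \<longleftrightarrow> p k < p j))"
    (is "_ \<longleftrightarrow> (\<exists>i j k. ?P i j k)")
proof
  assume "contains_pattern n p [a, b, c]"
  then obtain f where f: "strict_mono_on {..<3} f" "\<forall>j<3. f j \<in> {1..n}"
    "\<forall>j<3. \<forall>r<3. [a, b, c] ! j < [a, b, c] ! r \<longleftrightarrow> p (f j) < p (f r)"
    by (auto simp: contains_pattern_def numeral_3_eq_3)
  have "f 0 < f 1" "f 1 < f 2" using f(1) by (auto simp: strict_mono_on_def)
  moreover have "0 < f 0" "f 2 \<le> n" using f(2)[rule_format, of 0] f(2)[rule_format, of 2] by auto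
  ultimately have "?P (f 0) (f 1) (f 2)"
    using f(3) by (auto simp: numeral_3_eq_3 numeral_2_eq_2 All_less_Suc)
  then show "\<exists>i j k. ?P i j k" by blast
next
  assume "\<exists>i j k. ?P i j k"
  then obtain i j k where P: "?P i j k" by blast
  define f where "f m = [i, j, k] ! m" for m
  have f: "f 0 = i" "f (Suc 0) = j" "f (Suc (Suc 0)) = k" by (auto simp: f_def)
  have "strict_mono_on {..<length [a, b, c]} f"
    using P by (auto simp: strict_mono_on_def less_Suc_eq f)
  then show "contains_pattern n p [a, b, c]"
    unfolding contains_pattern_def using P
    by (intro exI[of _ f]) (auto simp: All_less_Suc f)
qed

lemma avoids_123_iff:
  "avoids_pattern n p [1, 2, 3] \<longleftrightarrow>
     (\<forall>i j k. 0 < i \<longrightarrow> i < j \<longrightarrow> j < k \<longrightarrow> k \<le> n \<longrightarrow> \<not> (p i < p j \<and> p j < p k))"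
proof -
  have "(((1::nat) < 2 \<longleftrightarrow> p i < p j) \<and> ((2::nat) < 1 \<longleftrightarrow> p j < p i) \<and>
         ((1::nat) < 3 \<longleftrightarrow> p i < p k) \<and> ((3::nat) < 1 \<longleftrightarrow> p k < p i) \<and>
         ((2::nat) < 3 \<longleftrightarrow> p j < p k) \<and> ((3::nat) < 2 \<longleftrightarrow> p k < p j)) \<longleftrightarrow>
        p i < p j \<and> p j < p k" for i j k
    by simp linarith
  then show ?thesis
    unfolding avoids_pattern_def contains_pattern_3 by (simp only:) blast
qed

lemma avoids_231_iff:
  "avoids_pattern n p [2, 3, 1] \<longleftrightarrow>
     (\<forall>i j k. 0 < i \<longrightarrow> i < j \<longrightarrow> j < k \<longrightarrow> k \<le> n \<longrightarrow> \<not> (p k < p i \<and> p i < p j))"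
proof -
  have "(((2::nat) < 3 \<longleftrightarrow> p i < p j) \<and> ((3::nat) < 2 \<longleftrightarrow> p j < p i) \<and>
         ((2::nat) < 1 \<longleftrightarrow> p i < p k) \<and> ((1::nat) < 2 \<longleftrightarrow> p k < p i) \<and>
         ((3::nat) < 1 \<longleftrightarrow> p j < p k) \<and> ((1::nat) < 3 \<longleftrightarrow> p k < p j)) \<longleftrightarrow>
        p k < p i \<and> p i < p j" for i j k
    by simp linarith
  then show ?thesis
    unfolding avoids_pattern_def contains_pattern_3 by (simp only:) blast
qed

lemma block_perm_avoids:
  assumes "d < N"
  shows "avoids_pattern (c + N) (block_perm c N d) [1, 2, 3]"
    and "avoids_pattern (c + N) (block_perm c N d) [2, 3, 1]"
  unfolding avoids_123_iff avoids_231_iff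
  using assms by (auto simp: block_perm_pieces split: if_splits)

text \<open>A decreasing run is determined by its set of values: counting the larger values in that
  set recovers each entry from its position.\<close>

lemma card_greater_image_antimono:
  fixes f :: "nat \<Rightarrow> nat"
  assumes dec: "\<And>i j. i \<in> A \<Longrightarrow> j \<in> A \<Longrightarrow> i < j \<Longrightarrow> f j < f i" and "i \<in> A"
  shows "card {y \<in> f ` A. f i < y} = card {j \<in> A. j < i}"
proof -
  have less_iff: "f i < f j \<longleftrightarrow> j < i" if "i \<in> A" "j \<in> A" for i j
    using dec[OF that] dec[OF that(2,1)] by (metis less_asym linorder_neqE_nat)
  have "{y \<in> f ` A. f i < y} = f ` {j \<in> A. j < i}"
    using less_iff assms(2) by auto
  moreover have "inj_on f {j \<in> A. j < i}"
    by (rule linorder_inj_onI') (use dec in fastforce)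
  ultimately show ?thesis by (simp add: card_image)
qed

text \<open>If 1 stands at position \<open>t < n\<close>, then \<open>N\<close> is the entry right
  after it and \<open>d = n - t\<close> counts the entries after it. If 1 comes last, the
  permutation is the reversal, with \<open>N = n\<close> and \<open>d = 0\<close>.\<close>

lemma avoider_is_block_perm:
  assumes p: "p permutes {1..n}" and "n > 0"
    and "avoids_pattern n p [1, 2, 3]" "avoids_pattern n p [2, 3, 1]"
  obtains c N d where "c + N = n" "d < N" "p = block_perm c N d"
proof -
  have no123: False if "0 < i" "i < j" "j < k" "k \<le> n" "p i < p j" "p j < p k" for i j k
    using assms(3) that unfolding avoids_123_iff by blast
  have no231: False if "0 < i" "i < j" "j < k" "k \<le> n" "p k < p i" "p i < p j" for i j k
    using assms(4) that unfolding avoids_231_iff by blast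
  have range: "0 < p i \<and> p i \<le> n" if "0 < i" "i \<le> n" for i
    using permutes_in_image[OF p, of i] that by auto
  have inj: "p i = p j \<longleftrightarrow> i = j" for i j
    using permutes_inj[OF p] by (auto dest: injD)
  have img: "p ` {1..n} = {1..n}" by (rule permutes_image[OF p])
  have outside: "p i = i" if "\<not> (0 < i \<and> i \<le> n)" for i
    using that by (intro permutes_not_in[OF p]) auto
  have surj: "\<exists>i. 0 < i \<and> i \<le> n \<and> p i = y" if "0 < y" "y \<le> n" for y
  proof -
    have "y \<in> p ` {1..n}" using img that by simp
    then obtain i where "i \<in> {1..n}" "p i = y" by blast
    then show ?thesis by (intro exI[of _ i]) auto
  qed
  obtain t where t: "0 < t" "t \<le> n" "p t = 1" using surj[of 1] \<open>n > 0\<close> by auto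
  have gt1: "p i > 1" if "0 < i" "i \<le> n" "i \<noteq> t" for i
    using range[OF that(1,2)] inj[of i t] that t by auto
  have decL: "p j < p i" if "0 < i" "i < j" "j \<le> t" for i j
  proof (cases "j = t")
    case True
    then show ?thesis using gt1[of i] that t by auto
  next
    case False
    then show ?thesis
      using no231[of i j t] gt1[of i] inj[of i j] that t by fastforce
  qed
  have decR: "p j < p i" if "t < i" "i < j" "j \<le> n" for i j
    using no123[of t i j] gt1[of i] inj[of i j] that t by fastforce
  have countL: "card {y \<in> p ` {1..t}. p i < y} = i - 1" if "0 < i" "i \<le> t" for i
  proof -
    have "{j \<in> {1..t}. j < i} = {1..<i}" using that by auto
    then show ?thesis
      using card_greater_image_antimono[of "{1..t}" p i] decL that by simp
  qed
  show ?thesis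
  proof (cases "t = n")
    case True
    have "p i = n + 1 - i" if i: "0 < i" "i \<le> n" for i
    proof -
      have "{y \<in> p ` {1..t}. p i < y} = {p i<..n}" using img True by auto
      then have "n - p i = i - 1" using countL[of i] i True by simp
      then show ?thesis using range[OF i] i by linarith
    qed
    then have "p i = block_perm 0 n 0 i" for i
      using outside[of i] \<open>n > 0\<close>
      by (cases "0 < i \<and> i \<le> n") (auto simp: block_perm_pieces, auto simp: block_perm_def)
    then show ?thesis using that[of 0 n 0] \<open>n > 0\<close> by auto
  next
    case False
    then have "t < n" using t by simp
    define v w where "v = p n" and "w = p (t + 1)"
    have "v > 1" using gt1[of n] \<open>t < n\<close> by (simp add: v_def)
    have "w \<le> n" using range[of "t + 1"] \<open>t < n\<close> by (simp add: w_def)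
    have imgR: "p ` {t + 1..n} = {v..w}"
    proof
      show "p ` {t + 1..n} \<subseteq> {v..w}"
      proof
        fix y assume "y \<in> p ` {t + 1..n}"
        then obtain i where i: "t + 1 \<le> i" "i \<le> n" "y = p i" by auto
        show "y \<in> {v..w}"
          using decR[of i n] decR[of "t + 1" i] i
          by (cases "i = n"; cases "i = t + 1") (auto simp: v_def w_def)
      qed
      show "{v..w} \<subseteq> p ` {t + 1..n}"
      proof
        fix y assume y: "y \<in> {v..w}"
        then obtain i where i: "0 < i" "i \<le> n" "p i = y"
          using surj[of y] \<open>v > 1\<close> \<open>w \<le> n\<close> by auto
        have "\<not> i \<le> t"
        proof
          assume "i \<le> t"
          then have "p i \<noteq> v" "p i \<noteq> w" using inj \<open>t < n\<close> by (auto simp: v_def w_def)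
          then have "v < p i" "p i < w" using y i by auto
          then have "t + 1 < n" using \<open>t < n\<close> by (cases "t + 1 = n") (auto simp: v_def w_def)
          \<comment> \<open>A value strictly between \<open>v\<close> and \<open>w\<close> placed
            before 1 would form 231 with \<open>w\<close> at \<open>t + 1\<close> and
            \<open>v\<close> at \<open>n\<close>.\<close>
          then show False
            using no231[of i "t + 1" n] i \<open>i \<le> t\<close> \<open>v < p i\<close> \<open>p i < w\<close>
            by (simp add: v_def w_def)
        qed
        then show "y \<in> p ` {t + 1..n}" using i by auto
      qed
    qed
    have inj_on: "inj_on p A" for A using inj by (simp add: inj_on_def)
    have len: "n - t = w + 1 - v"
      using card_image[OF inj_on, of "{t + 1..n}"] imgR by simp
    have right: "p i = w + t + 1 - i" if i: "t < i" "i \<le> n" for i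
    proof -
      have "p i \<in> {v..w}" unfolding imgR[symmetric] using i by auto
      then have "{y \<in> p ` {t + 1..n}. p i < y} = {p i<..w}" unfolding imgR by auto
      moreover have "{j \<in> {t + 1..n}. j < i} = {t + 1..<i}" using i by auto
      ultimately have "w - p i = i - (t + 1)"
        using card_greater_image_antimono[of "{t + 1..n}" p i] decR i by simp
      moreover have "p i \<le> w" using \<open>p i \<in> {v..w}\<close> by simp
      ultimately show ?thesis using i by linarith
    qed
    have imgL: "p ` {1..t} = {1..n} - {v..w}"
    proof -
      have "{1..t} = {1..n} - {t + 1..n}" using t by auto
      then have "p ` {1..t} = p ` {1..n} - p ` {t + 1..n}"
        using image_set_diff[OF permutes_inj[OF p]] by metis
      then show ?thesis by (simp only: img imgR)
    qed
    \<comment> \<open>The left values fill \<open>{1..n}\<close> outside \<open>{v..w}\<close>.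
      Above \<open>w\<close> an entry is as in the reversal; below \<open>v\<close> it is lower by
      the \<open>n - t\<close> values of the interval.\<close>
    have left: "p i > w \<and> p i + i = n + 1 \<or> p i < v \<and> p i + i + (n - t) = n + 1"
      if i: "0 < i" "i \<le> t" for i
    proof -
      have notin: "p i \<notin> {v..w}"
      proof -
        have "p i \<in> p ` {1..t}" using i by auto
        then show ?thesis unfolding imgL by blast
      qed
      have "p i \<le> n" using range[of i] i t by simp
      show ?thesis
      proof (cases "p i > w")
        case True
        then have "{y \<in> p ` {1..t}. p i < y} = {p i<..n}" unfolding imgL by auto
        then have "n - p i = i - 1" using countL[OF i] by simp
        then show ?thesis using True \<open>p i \<le> n\<close> i by linarith
      next
        case False
        then have "p i < v" using notin by auto
        then have "{y \<in> p ` {1..t}. p i < y} = {p i<..n} - {v..w}" unfolding imgL by auto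
        moreover have "card ({p i<..n} - {v..w}) = (n - p i) - (w + 1 - v)"
          using \<open>p i < v\<close> \<open>w \<le> n\<close> by (subst card_Diff_subset) auto
        ultimately have "(n - p i) - (n - t) = i - 1" using countL[OF i] len by simp
        moreover have "n - t \<le> n - p i" using len \<open>p i < v\<close> \<open>w \<le> n\<close> by linarith
        ultimately show ?thesis using \<open>p i < v\<close> i \<open>p i \<le> n\<close> by linarith
      qed
    qed
    have "n - t < w" using len \<open>v > 1\<close> \<open>t < n\<close> by linarith
    have "p i = block_perm (n - w) w (n - t) i" for i
    proof (cases "0 < i \<and> i \<le> n")
      case True
      then have i: "0 < i" "i \<le> n" by auto
      have eq: "block_perm (n - w) w (n - t) i =
          (if i \<le> n - w then n - w + w + 1 - i
           else if i \<le> n - w + (w - (n - t)) then n - w + w + 1 - (n - t) - i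
           else n - w + 2 * w + 1 - (n - t) - i)"
        using i \<open>n - t < w\<close> \<open>w \<le> n\<close> by (intro block_perm_pieces) auto
      \<comment> \<open>The second linear piece ends at the position of the entry 1.\<close>
      have t_eq: "n - w + (w - (n - t)) = t" using \<open>n - t < w\<close> \<open>w \<le> n\<close> t by linarith
      show ?thesis
      proof (cases "i \<le> t")
        case True
        then show ?thesis
          using left[OF i(1) True] \<open>w \<le> n\<close> len t \<open>t < n\<close> unfolding eq t_eq by (auto split: if_splits)
      next
        case False
        then have "p i = w + t + 1 - i" using right i by simp
        moreover have "\<not> i \<le> n - w" using False t_eq by linarith
        ultimately show ?thesis
          using False \<open>w \<le> n\<close> t unfolding eq t_eq by auto
      qed
    next
      case False
      then show ?thesis using outside[of i] \<open>w \<le> n\<close> by (auto simp: block_perm_def)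
    qed
    then show ?thesis using that[of "n - w" w "n - t"] \<open>w \<le> n\<close> \<open>n - t < w\<close> by auto
  qed
qed

section \<open>Counting the parameters\<close>

text \<open>The parameter \<open>d = 0\<close> is excluded because it gives the reversal for every \<open>N\<close>.\<close>

definition param_set :: "nat \<Rightarrow> (nat \<times> nat) set" where
  "param_set n = {(N, d). 0 < d \<and> d < N \<and> N \<le> n \<and> cyclic_params (n - N) N d}"

text \<open>Let \<open>N < N'\<close>. At position \<open>n - N' + 1\<close> the permutation for
  \<open>N\<close> is still in its initial reversal and has the entry \<open>N'\<close>, whereas the
  other has \<open>N' - d' < N'\<close>. For equal \<open>N\<close>, the entry \<open>N - d\<close>
  there determines \<open>d\<close>.\<close>

lemma inj_on_block_perm_params:
  "inj_on (\<lambda>(N, d). block_perm (n - N) N d) {(N, d). 0 < d \<and> d < N \<and> N \<le> n}"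
proof (rule inj_onI, clarify)
  fix N d N' d' :: nat
  assume d: "0 < d" "d < N" "N \<le> n" and d': "0 < d'" "d' < N'" "N' \<le> n"
    and eq: "block_perm (n - N) N d = block_perm (n - N') N' d'"
  have first: "block_perm (n - M) M e (n - M + 1) = M - e" if "e < M" "M \<le> n" for M e
    using block_perm_high[of 0 M "n - M" e] that by simp
  have before: "block_perm (n - M) M e (n - M' + 1) = M'"
    if "M < M'" "M' \<le> n" for M M' e
    using that by (subst block_perm_low) auto
  have "N = N'"
  proof (rule linorder_cases[of N N'])
    assume "N < N'"
    then show ?thesis using before[of N N' d] first[of d' N'] d d' eq by auto
  next
    assume "N' < N"
    then show ?thesis using before[of N' N d'] first[of d N] d d' eq by auto
  qed
  moreover have "N - d = N' - d'"
    using first[of d N] first[of d' N'] d d' eq calculation by simp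
  ultimately show "N = N' \<and> d = d'" using d d' by auto
qed

lemma num_cyclic_avoiding_eq_card_param_set:
  assumes "n > 2"
  shows "num_cyclic_avoiding n {[1,2,3], [2,3,1]} = card (param_set n)"
proof -
  let ?f = "\<lambda>(N, d). block_perm (n - N) N d"
  have "{p. cyclic_permutation n p \<and> (\<forall>q\<in>{[1,2,3], [2,3,1]}. avoids_pattern n p q)} = ?f ` param_set n"
    (is "?A = _")
  proof (intro equalityI subsetI)
    fix p assume "p \<in> ?A"
    then have p: "cyclic_permutation n p" "avoids_pattern n p [1,2,3]" "avoids_pattern n p [2,3,1]"
      by auto
    obtain c N d where cNd: "c + N = n" "d < N" "p = block_perm c N d"
      by (rule avoider_is_block_perm[of p n]) (use p assms in \<open>auto simp: cyclic_permutation_def\<close>)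
    then have "0 < d \<and> cyclic_params c N d"
      using cyclic_block_perm_iff[of c N d] p assms by simp
    then have "(N, d) \<in> param_set n" "p = ?f (N, d)"
      using cNd by (auto simp: param_set_def)
    then show "p \<in> ?f ` param_set n" by blast
  next
    fix p assume "p \<in> ?f ` param_set n"
    then obtain N d where Nd: "(N, d) \<in> param_set n" "p = block_perm (n - N) N d" by auto
    then have N: "n - N + N = n" "0 < d" "d < N" "cyclic_params (n - N) N d"
      by (auto simp: param_set_def)
    then show "p \<in> ?A"
      using cyclic_block_perm_iff[of "n - N" N d] block_perm_avoids[OF N(3), of "n - N"] assms Nd(2)
      by simp
  qed
  moreover have "inj_on ?f (param_set n)"
    by (rule inj_on_subset[OF inj_on_block_perm_params]) (auto simp: param_set_def)
  ultimately show ?thesis by (simp add: num_cyclic_avoiding_def card_image)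
qed

lemma in_totatives_iff_less: "N > 1 \<Longrightarrow> d \<in> totatives N \<longleftrightarrow> 0 < d \<and> d < N \<and> coprime d N"
  by (auto simp: in_totatives_iff intro: le_neq_trans)

text \<open>An odd \<open>n = c + N\<close> leaves only \<open>N = c + 1\<close>, that is
  \<open>N = m\<close>.\<close>

lemma card_param_set_odd:
  assumes "n = 2 * m - 1" "m > 1"
  shows "card (param_set n) = totient m"
proof -
  have "(N, d) \<in> param_set n \<longleftrightarrow> N = m \<and> 0 < d \<and> d < m \<and> coprime d m" for N d
  proof -
    have "n + 1 = 2 * m" using assms by simp
    then have "N \<le> n \<Longrightarrow> N = n - N + 1 \<longleftrightarrow> N = m" "N \<le> n \<Longrightarrow> N \<noteq> n - N"
      "N \<le> n \<Longrightarrow> N \<noteq> n - N + 2"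
      by arith+
    moreover have "m \<le> n" using assms by simp
    ultimately show ?thesis
      using assms unfolding param_set_def cyclic_params_def by auto
  qed
  then have "param_set n = {m} \<times> totatives m"
    using assms by (auto simp: in_totatives_iff_less)
  then show ?thesis by (simp add: totient_def card_cartesian_product)
qed

text \<open>The case \<open>N = c + 2\<close> would give the odd \<open>N = 2 * k + 1\<close>, for
  which the gcd cannot be 2.\<close>

lemma card_param_set_0_mod_4:
  assumes "n = 4 * k" "k > 0"
  shows "card (param_set n) = totient (2 * k)"
proof -
  have "(N, d) \<in> param_set n \<longleftrightarrow> N = 2 * k \<and> 0 < d \<and> d < 2 * k \<and> coprime d (2 * k)" for N d
  proof -
    have "N = n - N + 2 \<longleftrightarrow> N = 2 * k + 1" "N \<le> n \<Longrightarrow> N = n - N \<longleftrightarrow> N = 2 * k"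
      "N \<le> n \<Longrightarrow> N \<noteq> n - N + 1"
      using assms by presburger+
    moreover have "gcd d (2 * k + 1) \<noteq> 2"
      by (metis gcd_dvd2 odd_two_times_div_two_succ dvd_triv_left even_plus_one_iff)
    ultimately show ?thesis
      using assms unfolding param_set_def cyclic_params_def by auto
  qed
  then have "param_set n = {2 * k} \<times> totatives (2 * k)"
    using assms by (auto simp: in_totatives_iff_less)
  then show ?thesis by (simp add: totient_def card_cartesian_product)
qed

text \<open>Both \<open>N = c\<close> and \<open>N = c + 2\<close> contribute. In the latter,
  halving \<open>d\<close> turns gcd 2 with \<open>2 * k + 2\<close> into coprimality with
  \<open>k + 1\<close>.\<close>

lemma card_param_set_2_mod_4:
  assumes "n = 4 * k + 2" "k > 0"
  shows "card (param_set n) = totient (k + 1) + totient (2 * k + 1)"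
proof -
  let ?G = "{d \<in> {0<..2 * k + 2}. gcd d (2 * k + 2) = 2}"
  have params: "(N, d) \<in> param_set n \<longleftrightarrow>
     N = 2 * k + 1 \<and> 0 < d \<and> d < 2 * k + 1 \<and> coprime d (2 * k + 1) \<or>
     N = 2 * k + 2 \<and> 0 < d \<and> d < 2 * k + 2 \<and> gcd d (2 * k + 2) = 2" for N d
  proof -
    have "N \<le> n \<Longrightarrow> N = n - N + 2 \<longleftrightarrow> N = 2 * k + 2" "N \<le> n \<Longrightarrow> N = n - N \<longleftrightarrow> N = 2 * k + 1"
      "N \<le> n \<Longrightarrow> N \<noteq> n - N + 1" "2 * k + 2 \<le> n"
      using assms by presburger+
    then show ?thesis
      using assms unfolding param_set_def cyclic_params_def by auto
  qed
  \<comment> \<open>\<open>?G\<close> includes the endpoint \<open>2 * k + 2\<close> to match the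
    totient count; its gcd is \<open>2 * k + 2\<close>, which is not 2 since
    \<open>k > 0\<close>.\<close>
  have G: "d \<in> ?G \<longleftrightarrow> 0 < d \<and> d < 2 * k + 2 \<and> gcd d (2 * k + 2) = 2" for d
    using assms by (cases "d = 2 * k + 2") auto
  have totatives: "d \<in> totatives (2 * k + 1) \<longleftrightarrow> 0 < d \<and> d < 2 * k + 1 \<and> coprime d (2 * k + 1)" for d
    using assms by (intro in_totatives_iff_less) simp
  have split: "param_set n = {2 * k + 1} \<times> totatives (2 * k + 1) \<union> {2 * k + 2} \<times> ?G"
    by (rule set_eqI, rename_tac x, case_tac x)
       (simp only: params Un_iff mem_Sigma_iff singleton_iff G totatives)
  have disjoint: "({2 * k + 1} \<times> totatives (2 * k + 1)) \<inter> ({2 * k + 2} \<times> ?G) = {}"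
    by auto
  have fin: "finite ({2 * k + 1} \<times> totatives (2 * k + 1))" "finite ({2 * k + 2} \<times> ?G)"
    by simp_all
  have "card (param_set n) =
      card ({2 * k + 1} \<times> totatives (2 * k + 1)) + card ({2 * k + 2} \<times> ?G)"
    unfolding split by (rule card_Un_disjoint[OF fin disjoint])
  also have "\<dots> = totient (2 * k + 1) + card ?G"
    by (simp only: card_cartesian_product_singleton totient_def)
  also have "card ?G = totient (k + 1)"
    using card_gcd_eq_totient[of "2 * k + 2" 2] by simp
  finally show ?thesis by simp
qed

theorem theorem18:
  fixes n :: nat
  assumes "n > 2"
  shows "(\<forall>k>0. n = 4 * k \<longrightarrow>
            num_cyclic_avoiding n {[1,2,3], [2,3,1]} = totient (2 * k) \<and>
            totient (2 * k) = totient (n div 2)) \<and>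
         (\<forall>k>0. n = 4 * k + 2 \<longrightarrow>
            num_cyclic_avoiding n {[1,2,3], [2,3,1]} = totient (k + 1) + totient (2 * k + 1) \<and>
            totient (k + 1) + totient (2 * k + 1) = totient ((n + 2) div 4) + totient (n div 2)) \<and>
         (\<forall>m>0. n = 2 * m - 1 \<longrightarrow>
            num_cyclic_avoiding n {[1,2,3], [2,3,1]} = totient m \<and>
            totient m = totient ((n + 1) div 2))"
  unfolding num_cyclic_avoiding_eq_card_param_set[OF assms]
proof (intro conjI allI impI)
  fix k assume k: "0 < k" "n = 4 * k"
  show "card (param_set n) = totient (2 * k)" using k by (simp add: card_param_set_0_mod_4)
  show "totient (2 * k) = totient (n div 2)" using k by simp
next
  fix k assume k: "0 < k" "n = 4 * k + 2"
  show "card (param_set n) = totient (k + 1) + totient (2 * k + 1)"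
    using k by (intro card_param_set_2_mod_4)
  have "(n + 2) div 4 = k + 1" "n div 2 = 2 * k + 1" using k by auto
  then show "totient (k + 1) + totient (2 * k + 1) = totient ((n + 2) div 4) + totient (n div 2)"
    by simp
next
  fix m assume m: "0 < m" "n = 2 * m - 1"
  show "card (param_set n) = totient m" using m assms by (intro card_param_set_odd) auto
  have "(n + 1) div 2 = m" using m by auto
  then show "totient m = totient ((n + 1) div 2)" by simp
qed

end
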